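(* Let $\widehat{A}=A+\epsilon B\in\mathbb{DR}^{n\times n}$ with $\operatorname{Ind}(A)=m$, and let $\widehat{b}\in\mathbb{DR}^{n}$. If both the dual core-EP generalized inverse $\widehat{A}^{\dagger_c}$ and the dual Drazin generalized inverse $\widehat{A}^{D}$ exist, then the system $$\widehat{A}^{m+1}\widehat{x}=\widehat{A}^{2m}(\widehat{A}^{m})^{\dagger}\widehat{b}$$ in the unknown $\widehat{x}\in\mathbb{DR}^n$ is consistent and its general solution is given by $$\widehat{x}=\widehat{A}^{\dagger_c}\widehat{b}+(I-\widehat{A}^{D}\widehat{A})\widehat{y},$$ where $\widehat{y}\in\mathbb{DR}^{n}$ is any dual vector.
   Context: Dual numbers are $a+\epsilon b$ with $a,b\in\mathbb{R}$, $\epsilon\neq 0$, $\epsilon^2=0$. $\mathbb{DR}^{n\times n}$ (resp. $\mathbb{DR}^n$) is the set of dual real matrices $\widehat{A}=A+\epsilon B$ (resp. vectors), with product $(A+\epsilon B)(C+\epsilon D)=AC+\epsilon(AD+BC)$ and transpose $(A+\epsilon B)^T=A^T+\epsilon B^T$. $\operatorname{Ind}(A)$ is the smallest nonnegative integer $s$ with $\operatorname{rank}(A^{s+1})=\operatorname{rank}(A^s)$. For $\widehat{A}=A+\epsilon B$ with $\operatorname{Ind}(A)=m$: the dual core-EP generalized inverse $\widehat{A}^{\dagger_c}$ is the $\widehat{X}\in\mathbb{DR}^{n\times n}$ (unique if it exists) with $(\widehat{A}\widehat{X})^{T}=\widehat{A}\widehat{X}$, $\widehat{A}\widehat{X}^{2}=\widehat{X}$,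 $\widehat{X}\widehat{A}^{m+1}=\widehat{A}^{m}$; the dual Drazin generalized inverse $\widehat{A}^{D}$ is the $\widehat{X}$ (unique if it exists) with $\widehat{X}\widehat{A}^{m+1}=\widehat{A}^m$, $\widehat{X}\widehat{A}\widehat{X}=\widehat{X}$, $\widehat{A}\widehat{X}=\widehat{X}\widehat{A}$. For a dual matrix $\widehat{C}$, the dual Moore-Penrose inverse $\widehat{C}^{\dagger}$ is the $\widehat{X}$ (unique if it exists) with $\widehat{C}\widehat{X}\widehat{C}=\widehat{C}$, $\widehat{X}\widehat{C}\widehat{X}=\widehat{X}$, $(\widehat{C}\widehat{X})^T=\widehat{C}\widehat{X}$, $(\widehat{X}\widehat{C})^T=\widehat{X}\widehat{C}$; it is a known result that $(\widehat{A}^m)^{\dagger}$ exists if and only if $\widehat{A}^{D}$ exists. *)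

theory Defs
  imports "HOL-Analysis.Analysis"
begin

text \<open>
  Dual numbers \<open>a + \<epsilon> b\<close> with real \<open>a\<close>, \<open>b\<close> and \<open>\<epsilon>\<^sup>2 = 0\<close> form a commutative ring, so vectors and
  matrices over them are handled by the library types \<open>dual ^ 'n\<close> and \<open>dual ^ 'n ^ 'n\<close> with their
  generic operations \<open>**\<close>, \<open>*v\<close>, \<open>mat 1\<close> and \<open>transpose\<close>.
\<close>

datatype dual = Dual (std_part: real) (inf_part: real)

instantiation dual :: comm_ring_1
begin

definition "0 = Dual 0 0"
definition "1 = Dual 1 0"
definition "x + y = Dual (std_part x + std_part y) (inf_part x + inf_part y)"
definition "- x = Dual (- std_part x) (- inf_part x)"
definition "x - y = Dual (std_part x - std_part y) (inf_part x - inf_part y)"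
definition "x * y =
  Dual (std_part x * std_part y) (std_part x * inf_part y + inf_part x * std_part y)"

instance
  by standard
    (simp_all add: zero_dual_def one_dual_def plus_dual_def uminus_dual_def minus_dual_def
      times_dual_def algebra_simps dual.expand)

end

lemma dual_simps [simp]:
  "std_part 0 = 0" "inf_part 0 = 0" "std_part 1 = 1" "inf_part 1 = 0"
  "std_part (x + y) = std_part x + std_part y" "inf_part (x + y) = inf_part x + inf_part y"
  "std_part (- x) = - std_part x" "inf_part (- x) = - inf_part x"
  "std_part (x - y) = std_part x - std_part y" "inf_part (x - y) = inf_part x - inf_part y"
  "std_part (x * y) = std_part x * std_part y"
  "inf_part (x * y) = std_part x * inf_part y + inf_part x * std_part y"
  by (simp_all add: zero_dual_def one_dual_def plus_dual_def uminus_dual_def minus_dual_def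
      times_dual_def)

definition dual_matrix :: "real ^ 'n ^ 'm \<Rightarrow> real ^ 'n ^ 'm \<Rightarrow> dual ^ 'n ^ 'm" where
  "dual_matrix A B = (\<chi> i j. Dual (A $ i $ j) (B $ i $ j))"

definition std_matrix :: "dual ^ 'n ^ 'm \<Rightarrow> real ^ 'n ^ 'm" where
  "std_matrix M = map_matrix std_part M"

lemma std_matrix_dual_matrix [simp]: "std_matrix (dual_matrix A B) = A"
  by (simp add: std_matrix_def dual_matrix_def vec_eq_iff)

lemma std_part_sum: "std_part (sum f S) = (\<Sum>i\<in>S. std_part (f i))"
  by (induction S rule: infinite_finite_induct) auto

lemma inf_part_sum: "inf_part (sum f S) = (\<Sum>i\<in>S. inf_part (f i))"
  by (induction S rule: infinite_finite_induct) auto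

lemma dual_matrix_mult:
  "dual_matrix A B ** dual_matrix C D = dual_matrix (A ** C) (A ** D + B ** C)"
  by (simp add: vec_eq_iff dual_matrix_def matrix_matrix_mult_def dual.expand
      std_part_sum inf_part_sum sum.distrib)

lemma transpose_dual_matrix: "transpose (dual_matrix A B) = dual_matrix (transpose A) (transpose B)"
  by (simp add: transpose_def dual_matrix_def vec_eq_iff)

primrec matpow :: "'a::semiring_1 ^ 'n ^ 'n \<Rightarrow> nat \<Rightarrow> 'a ^ 'n ^ 'n" where
  "matpow A 0 = mat 1"
| "matpow A (Suc k) = A ** matpow A k"

definition matrix_index :: "real ^ 'n ^ 'n \<Rightarrow> nat" where
  "matrix_index A = (LEAST s. rank (matpow A (s + 1)) = rank (matpow A s))"

definition is_dual_core_EP :: "dual ^ 'n ^ 'n \<Rightarrow> dual ^ 'n ^ 'n \<Rightarrow> bool" where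
  "is_dual_core_EP A X \<longleftrightarrow>
    (let m = matrix_index (std_matrix A) in
      transpose (A ** X) = A ** X \<and>
      A ** matpow X 2 = X \<and>
      X ** matpow A (m + 1) = matpow A m)"

definition is_dual_Drazin :: "dual ^ 'n ^ 'n \<Rightarrow> dual ^ 'n ^ 'n \<Rightarrow> bool" where
  "is_dual_Drazin A X \<longleftrightarrow>
    (let m = matrix_index (std_matrix A) in
      X ** matpow A (m + 1) = matpow A m \<and>
      X ** A ** X = X \<and>
      A ** X = X ** A)"

definition is_dual_MP :: "dual ^ 'n ^ 'm \<Rightarrow> dual ^ 'm ^ 'n \<Rightarrow> bool" where
  "is_dual_MP C X \<longleftrightarrow>
    C ** X ** C = C \<and>
    X ** C ** X = X \<and>
    transpose (C ** X) = C ** X \<and>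
    transpose (X ** C) = X ** C"

text \<open>
  The three inverses are unique when they exist; the descriptions below are unspecified otherwise.
\<close>

definition dual_core_EP :: "dual ^ 'n ^ 'n \<Rightarrow> dual ^ 'n ^ 'n" where
  "dual_core_EP A = (THE X. is_dual_core_EP A X)"

definition dual_Drazin :: "dual ^ 'n ^ 'n \<Rightarrow> dual ^ 'n ^ 'n" where
  "dual_Drazin A = (THE X. is_dual_Drazin A X)"

definition dual_MP :: "dual ^ 'n ^ 'm \<Rightarrow> dual ^ 'm ^ 'n" where
  "dual_MP C = (THE X. is_dual_MP C X)"

end

theory Submission
  imports Defs
begin

text \<open>
  Write \<open>C = A\<^sup>m\<close>, and let \<open>X\<close> and \<open>D\<close> be the core-EP and the Drazin inverse of \<open>A\<close>. The equation
  \<open>A X\<^sup>2 = X\<close> lets one insert powers, so \<open>A X = A\<^sup>k X\<^sup>k\<close> for every \<open>k \<ge> 1\<close>; together with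
  \<open>A X C = C\<close> this makes \<open>A X\<close> a symmetric matrix that projects onto the range of \<open>C\<close>. The matrix
  \<open>C C\<^sup>\<dagger>\<close> is another one, and such a projector is unique, so \<open>C C\<^sup>\<dagger> = A X\<close>
  (\<open>core_EP_projector_eq\<close>). The right-hand side of the system is therefore
  \<open>A\<^sup>m C C\<^sup>\<dagger> b = A\<^sup>m\<^sup>+\<^sup>1 X b\<close>, which exhibits \<open>X b\<close> as a solution. The other solutions differ from it
  by the kernel of \<open>A\<^sup>m\<^sup>+\<^sup>1\<close>, and this is the range of the complementary projector \<open>I - D A\<close>,
  because \<open>A\<^sup>m\<^sup>+\<^sup>1 D A = A\<^sup>m\<^sup>+\<^sup>1\<close> and \<open>D A = D\<^sup>m\<^sup>+\<^sup>1 A\<^sup>m\<^sup>+\<^sup>1\<close> (\<open>Drazin_kernel_iff\<close>).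

  This argument uses that \<open>C\<^sup>\<dagger>\<close> exists, which is not automatic over the dual numbers. The
  Drazin inverse gives \<open>C D\<^sup>m C = C\<close>, and a regular dual matrix, that is one with \<open>C G C = C\<close> for some \<open>G\<close>, has a
  Moore--Penrose inverse (\<open>regular_imp_is_dual_MP\<close>): the idempotents \<open>C G\<close> and \<open>(G C)\<^sup>T\<close> can be
  replaced by symmetric projectors with the same range. Kaplansky's formula for these projectors
  needs the inverse of a matrix of the form \<open>I + N\<^sup>T N\<close>. Its standard part has the same form over
  the reals and so is positive definite, and a dual matrix is invertible as soon as its standard
  part is.
\<close>

section \<open>Matrix algebra over a commutative ring\<close>

lemma matrix_diff_ldistrib:
  fixes A :: "'a::comm_ring_1 ^ 'n ^ 'm"
  shows "A ** (B - C) = A ** B - A ** C"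
  by (simp add: vec_eq_iff matrix_matrix_mult_def right_diff_distrib sum_subtractf)

lemma matrix_diff_rdistrib:
  fixes A :: "'a::comm_ring_1 ^ 'n ^ 'm"
  shows "(A - B) ** C = A ** C - B ** C"
  by (simp add: vec_eq_iff matrix_matrix_mult_def left_diff_distrib sum_subtractf)

lemma matrix_add_rdistrib:
  fixes A :: "'a::comm_ring_1 ^ 'n ^ 'm"
  shows "(A + B) ** C = A ** C + B ** C"
  by (simp add: vec_eq_iff matrix_matrix_mult_def distrib_right sum.distrib)

lemma transpose_add: "transpose (A + B) = transpose A + transpose B"
  by (simp add: vec_eq_iff transpose_def)

lemma transpose_diff: "transpose (A - B) = transpose A - transpose B"
  by (simp add: vec_eq_iff transpose_def)

lemma matpow_add: "matpow A (j + k) = matpow A j ** matpow A k"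
  by (induction j) (simp_all add: matrix_mul_assoc)

lemma matpow_Suc_right: "matpow A (Suc k) = matpow A k ** A"
  using matpow_add[of A k 1] by simp

text \<open>
  Induction peels off an outer factor \<open>U\<close> and \<open>V\<close>: what remains is \<open>U V\<close>, and
  \<open>U (U V) V = (U V) (U V)\<close>.
\<close>

lemma matpow_commuting_idempotent:
  assumes comm: "U ** V = V ** U" and idem: "(U ** V) ** (U ** V) = U ** V"
  shows "matpow U (Suc k) ** matpow V (Suc k) = U ** V"
proof (induction k)
  case (Suc k)
  have "matpow U (Suc (Suc k)) ** matpow V (Suc (Suc k))
      = U ** (matpow U (Suc k) ** matpow V (Suc k)) ** V"
    by (simp only: matpow.simps(2)[of U "Suc k"] matpow_Suc_right[of V "Suc k"] matrix_mul_assoc)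
  also have "\<dots> = U ** (V ** U) ** V"
    by (simp only: Suc.IH comm)
  also have "\<dots> = U ** V"
    using idem by (simp only: matrix_mul_assoc)
  finally show ?case .
qed simp

section \<open>Moore--Penrose inverses of regular dual matrices\<close>

text \<open>
  The hypotheses \<open>P Q = Q\<close> and \<open>Q P = P\<close> say that the two projectors have the same range;
  transposing the first one turns it into \<open>Q P = Q\<close>.
\<close>

lemma symmetric_projectors_same_range_eq:
  fixes P Q :: "'a::comm_ring_1 ^ 'n ^ 'n"
  assumes "transpose P = P" and "transpose Q = Q" and "P ** Q = Q" and "Q ** P = P"
  shows "P = Q"
proof -
  have "Q = transpose (P ** Q)"
    using assms by simp
  also have "\<dots> = transpose Q ** transpose P"
    by (rule matrix_transpose_mul)
  also have "\<dots> = P"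
    by (simp only: assms)
  finally show ?thesis by simp
qed

lemma symmetric_range_projector_unique:
  fixes C :: "'a::comm_ring_1 ^ 'n ^ 'm"
  assumes "C ** X ** C = C" and "transpose (C ** X) = C ** X"
    and "C ** Y ** C = C" and "transpose (C ** Y) = C ** Y"
  shows "C ** X = C ** Y"
  using assms by - (rule symmetric_projectors_same_range_eq, simp_all add: matrix_mul_assoc)

lemma is_dual_MP_transpose:
  "is_dual_MP (transpose C) (transpose X) \<longleftrightarrow> is_dual_MP C X"
  unfolding is_dual_MP_def
  by (auto simp add: matrix_mul_assoc simp flip: matrix_transpose_mul)

lemma is_dual_MP_unique:
  assumes X: "is_dual_MP C X" and Y: "is_dual_MP C Y"
  shows "X = Y"
proof -
  have left: "C ** X = C ** Y"
    using X Y unfolding is_dual_MP_def by - (rule symmetric_range_projector_unique, simp_all)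
  have "is_dual_MP (transpose C) (transpose X)" "is_dual_MP (transpose C) (transpose Y)"
    using X Y by (simp_all only: is_dual_MP_transpose)
  then have "transpose C ** transpose X = transpose C ** transpose Y"
    unfolding is_dual_MP_def by - (rule symmetric_range_projector_unique, simp_all)
  then have right: "X ** C = Y ** C"
    by (metis matrix_transpose_mul transpose_transpose)
  have "X = X ** C ** X" using X by (simp add: is_dual_MP_def)
  also have "\<dots> = Y ** (C ** X)"
    by (simp only: right matrix_mul_assoc)
  also have "\<dots> = Y ** C ** Y"
    by (simp only: left matrix_mul_assoc)
  also have "\<dots> = Y" using Y by (simp add: is_dual_MP_def)
  finally show ?thesis .
qed

lemma dual_MP_eqI: "is_dual_MP C X \<Longrightarrow> dual_MP C = X"
  unfolding dual_MP_def by (blast intro: is_dual_MP_unique)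

lemma dual_matrix_parts: "dual_matrix (std_matrix M) (map_matrix inf_part M) = M"
  by (simp add: vec_eq_iff dual_matrix_def std_matrix_def)

lemma std_matrix_mult: "std_matrix (M ** N) = std_matrix M ** std_matrix N"
  by (simp add: vec_eq_iff std_matrix_def matrix_matrix_mult_def std_part_sum)

lemma std_matrix_mat_1: "std_matrix (mat 1) = mat 1"
  by (simp add: vec_eq_iff std_matrix_def mat_def)

lemma std_matrix_transpose: "std_matrix (transpose M) = transpose (std_matrix M)"
  by (simp add: vec_eq_iff std_matrix_def transpose_def)

lemma std_matrix_add: "std_matrix (M + N) = std_matrix M + std_matrix N"
  by (simp add: vec_eq_iff std_matrix_def)

text \<open>
  The inverse of \<open>S + \<epsilon> T\<close> is the truncated Neumann series
  \<open>S\<^sup>-\<^sup>1 - \<epsilon> S\<^sup>-\<^sup>1 T S\<^sup>-\<^sup>1\<close>, which is exact because \<open>\<epsilon>\<^sup>2 = 0\<close>.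
\<close>

lemma invertible_if_invertible_std_matrix:
  fixes M :: "dual ^ 'n ^ 'n"
  assumes "invertible (std_matrix M)"
  shows "invertible M"
proof -
  define S where "S = std_matrix M"
  define T where "T = map_matrix inf_part M"
  obtain R where R: "S ** R = mat 1" "R ** S = mat 1"
    using assms unfolding S_def invertible_def by blast
  have M: "M = dual_matrix S T"
    by (simp add: S_def T_def dual_matrix_parts)
  have one: "dual_matrix (mat 1) 0 = (mat 1 :: dual ^ 'n ^ 'n)"
    by (simp add: vec_eq_iff dual_matrix_def mat_def zero_dual_def one_dual_def)
  have neg: "X ** (- Y) = - (X ** Y)" "(- X) ** Y = - (X ** Y)" for X Y :: "real ^ 'n ^ 'n"
    by (simp_all add: vec_eq_iff matrix_matrix_mult_def sum_negf)
  have "M ** dual_matrix R (- (R ** T ** R)) = mat 1"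
    using R by (simp add: M dual_matrix_mult matrix_mul_assoc neg flip: one)
  moreover have "R ** T ** R ** S = R ** T"
    using R by (simp flip: matrix_mul_assoc)
  then have "dual_matrix R (- (R ** T ** R)) ** M = mat 1"
    using R by (simp add: M dual_matrix_mult neg flip: one)
  ultimately show ?thesis
    unfolding invertible_def by blast
qed

text \<open>
  A vector \<open>x\<close> in the kernel satisfies \<open>\<bar>x\<bar>\<^sup>2 + \<bar>N x\<bar>\<^sup>2 = 0\<close>.
\<close>

lemma invertible_one_plus_gram:
  fixes N :: "real ^ 'n ^ 'm"
  shows "invertible (mat 1 + transpose N ** N)"
proof -
  have "x = 0" if "(mat 1 + transpose N ** N) *v x = 0" for x
  proof -
    have "x \<bullet> x + (N *v x) \<bullet> (N *v x) = x \<bullet> ((mat 1 + transpose N ** N) *v x)"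
      using dot_lmul_matrix[of x "transpose N" "N *v x"]
      by (simp add: matrix_vector_mult_add_rdistrib inner_add_right
          del: transpose_matrix_vector flip: matrix_vector_mul_assoc)
    then have "x \<bullet> x + (N *v x) \<bullet> (N *v x) = 0"
      using that by simp
    then show "x = 0"
      by (metis add_nonneg_eq_0_iff inner_eq_zero_iff inner_ge_zero)
  qed
  then show ?thesis
    by (simp add: invertible_left_inverse matrix_left_invertible_ker)
qed

text \<open>
  Kaplansky's formula: the symmetric projector onto the range of an idempotent \<open>E\<close> is
  \<open>E E\<^sup>T Z\<^sup>-\<^sup>1\<close> with \<open>Z = I + (E\<^sup>T - E)\<^sup>T (E\<^sup>T - E)\<close>. It works because \<open>Z\<close> commutes with \<open>E\<close>
  and \<open>E\<^sup>T\<close> and because \<open>E E\<^sup>T E = E Z\<close>.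
\<close>

lemma idempotent_symmetric_range_projector:
  fixes E :: "dual ^ 'n ^ 'n"
  assumes idem: "E ** E = E"
  obtains P where "transpose P = P" and "P ** E = E" and "E ** P = P"
proof -
  let ?F = "transpose E"
  define Z where "Z = mat 1 - E - ?F + E ** ?F + ?F ** E"
  note distribs = matrix_add_ldistrib matrix_add_rdistrib matrix_diff_ldistrib matrix_diff_rdistrib
  have idemF: "?F ** ?F = ?F"
    by (metis idem matrix_transpose_mul)
  have Z_gram: "Z = mat 1 + transpose (?F - E) ** (?F - E)"
    by (simp add: Z_def transpose_diff distribs idem idemF)
  have "invertible (std_matrix Z)"
    unfolding Z_gram
    by (simp add: std_matrix_add std_matrix_mult std_matrix_mat_1 std_matrix_transpose
        invertible_one_plus_gram)
  then obtain W where W: "Z ** W = mat 1" "W ** Z = mat 1"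
    using invertible_if_invertible_std_matrix invertible_def by blast
  have symZ: "transpose Z = Z"
    by (simp add: Z_def transpose_add transpose_diff matrix_transpose_mul)
  have EZ: "E ** Z = E ** ?F ** E" and ZE: "Z ** E = E ** ?F ** E"
    using idem by (simp_all add: Z_def distribs matrix_mul_assoc) (simp flip: matrix_mul_assoc)
  have FZ: "?F ** Z = Z ** ?F"
    by (metis EZ ZE matrix_transpose_mul symZ)
  have comm: "M ** W = W ** M" if "M ** Z = Z ** M" for M
    by (metis W that matrix_mul_assoc matrix_mul_lid matrix_mul_rid)
  have EW: "E ** W = W ** E" and FW: "?F ** W = W ** ?F"
    using comm EZ ZE FZ by simp_all
  have "transpose W ** Z = mat 1"
    using arg_cong[OF W(1), of transpose] by (simp add: matrix_transpose_mul symZ)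
  then have symW: "transpose W = W"
    by (metis W(1) matrix_mul_assoc matrix_mul_lid matrix_mul_rid)
  let ?P = "E ** ?F ** W"
  have "transpose ?P = W ** (E ** ?F)"
    by (simp add: matrix_transpose_mul symW)
  then have "transpose ?P = ?P"
    by (metis EW FW matrix_mul_assoc)
  moreover have "?P ** E = E ** Z ** W"
    by (metis EW EZ matrix_mul_assoc)
  then have "?P ** E = E"
    by (metis W(1) matrix_mul_assoc matrix_mul_rid)
  moreover have "E ** ?P = ?P"
    by (simp add: matrix_mul_assoc idem)
  ultimately show ?thesis ..
qed

lemma regular_symmetric_range_projector:
  fixes C :: "dual ^ 'n ^ 'm"
  assumes reg: "C ** G ** C = C"
  obtains X where "C ** X ** C = C" and "transpose (C ** X) = C ** X"
proof -
  have "(C ** G) ** (C ** G) = C ** G"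
    using reg by (simp add: matrix_mul_assoc)
  then obtain P where P: "transpose P = P" "P ** (C ** G) = C ** G" "C ** G ** P = P"
    by (rule idempotent_symmetric_range_projector)
  have "C ** (G ** P) = P"
    using P(3) by (simp add: matrix_mul_assoc)
  moreover have "P ** C = C"
    by (metis P(2) reg matrix_mul_assoc)
  ultimately show ?thesis
    using that[of "G ** P"] P(1) by simp
qed

text \<open>
  The preceding lemma, applied to \<open>C\<close> and to its transpose, gives inner inverses \<open>X\<close> and \<open>Y\<close> of
  \<open>C\<close> for which \<open>C X\<close> and \<open>Y C\<close> are symmetric. Then \<open>Y C X\<close> inherits both symmetries, because
  \<open>C (Y C X) = C X\<close> and \<open>(Y C X) C = Y C\<close>.
\<close>

lemma regular_imp_is_dual_MP:
  fixes C :: "dual ^ 'n ^ 'm"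
  assumes reg: "C ** G ** C = C"
  shows "\<exists>X. is_dual_MP C X"
proof -
  obtain X where X: "C ** X ** C = C" "transpose (C ** X) = C ** X"
    using reg by (rule regular_symmetric_range_projector)
  have "transpose C ** transpose G ** transpose C = transpose C"
    by (metis reg matrix_transpose_mul matrix_mul_assoc)
  then obtain Y' where Y': "transpose C ** Y' ** transpose C = transpose C"
      "transpose (transpose C ** Y') = transpose C ** Y'"
    by (rule regular_symmetric_range_projector)
  define Y where "Y = transpose Y'"
  have Y: "C ** Y ** C = C" "transpose (Y ** C) = Y ** C"
    using arg_cong[OF Y'(1), of transpose] Y'(2)
    by (simp_all add: Y_def matrix_transpose_mul matrix_mul_assoc)
  have CX: "C ** (Y ** C ** X) = C ** X" and XC: "(Y ** C ** X) ** C = Y ** C"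
    using X Y by (simp_all add: matrix_mul_assoc) (metis X(1) matrix_mul_assoc)
  have "Y ** C ** (Y ** C ** X) = Y ** C ** X"
    by (metis Y(1) matrix_mul_assoc)
  then have "is_dual_MP C (Y ** C ** X)"
    unfolding is_dual_MP_def CX XC using X Y by simp
  then show ?thesis ..
qed

section \<open>The core-EP and Drazin identities\<close>

lemma outer_power_absorb:
  assumes "A ** X ** X = X"
  shows "matpow A k ** matpow X (Suc k) = X"
proof (induction k)
  case (Suc k)
  have "matpow A (Suc k) ** matpow X (Suc (Suc k)) = A ** (matpow A k ** matpow X (Suc k)) ** X"
    by (simp only: matpow.simps(2)[of A k] matpow_Suc_right[of X "Suc k"] matrix_mul_assoc)
  then show ?case
    using Suc assms by simp
qed simp

lemma core_EP_projector_power: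
  assumes "A ** X ** X = X"
  shows "matpow A (Suc k) ** matpow X (Suc k) = A ** X"
  using outer_power_absorb[OF assms, of k] by (simp flip: matrix_mul_assoc)

lemma core_EP_projector_fixes_power:
  assumes AXX: "A ** X ** X = X" and XA: "X ** matpow A (Suc k) = matpow A k"
  shows "A ** X ** matpow A k = matpow A k"
  by (metis AXX XA matrix_mul_assoc)

lemma is_dual_core_EP_iff:
  assumes "matrix_index (std_matrix A) = m"
  shows "is_dual_core_EP A X \<longleftrightarrow>
    transpose (A ** X) = A ** X \<and> A ** X ** X = X \<and> X ** matpow A (Suc m) = matpow A m"
  unfolding is_dual_core_EP_def using assms by (simp add: numeral_2_eq_2 matrix_mul_assoc)

text \<open>
  Each of \<open>A X\<close> and \<open>A\<^sup>m Y\<close> fixes \<open>A\<^sup>m\<close>, and each factors through \<open>A\<^sup>m\<close> on the left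
  (\<open>A X = A\<^sup>m\<^sup>+\<^sup>1 X\<^sup>m\<^sup>+\<^sup>1\<close>), so both project onto its range.
\<close>

lemma core_EP_projector_eq:
  fixes A :: "dual ^ 'n ^ 'n"
  assumes X: "is_dual_core_EP A X" and m: "matrix_index (std_matrix A) = m"
    and Y: "matpow A m ** Y ** matpow A m = matpow A m"
      "transpose (matpow A m ** Y) = matpow A m ** Y"
  shows "matpow A m ** Y = A ** X"
proof (rule symmetric_projectors_same_range_eq)
  have AXX: "A ** X ** X = X" and XA: "X ** matpow A (Suc m) = matpow A m"
    using X unfolding is_dual_core_EP_iff[OF m] by simp_all
  show "transpose (A ** X) = A ** X"
    using X unfolding is_dual_core_EP_iff[OF m] by simp
  show "A ** X ** (matpow A m ** Y) = matpow A m ** Y"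
    by (simp add: matrix_mul_assoc core_EP_projector_fixes_power[OF AXX XA])
  have "A ** X = matpow A m ** (A ** matpow X (Suc m))"
    by (metis core_EP_projector_power[OF AXX] matpow_Suc_right matrix_mul_assoc)
  then show "matpow A m ** Y ** (A ** X) = A ** X"
    by (simp add: matrix_mul_assoc Y)
qed (fact Y)

text \<open>
  As above, \<open>A X\<close> and \<open>A Y\<close> are the same projector. It determines the inverse: \<open>X\<close> is a left
  inverse of \<open>A\<close> on \<open>A\<^sup>m\<close>, and \<open>Z = A\<^sup>m Z\<^sup>m\<^sup>+\<^sup>1\<close> for each core-EP inverse \<open>Z\<close>, so \<open>X (A Z) = Z\<close>.
\<close>

lemma is_dual_core_EP_unique:
  fixes A :: "dual ^ 'n ^ 'n"
  assumes X: "is_dual_core_EP A X" and Y: "is_dual_core_EP A Y"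
  shows "X = Y"
proof -
  define m where "m = matrix_index (std_matrix A)"
  note iff = is_dual_core_EP_iff[OF m_def[symmetric]]
  have X': "A ** X ** X = X" "X ** matpow A (Suc m) = matpow A m"
    and Y': "A ** Y ** Y = Y" "Y ** matpow A (Suc m) = matpow A m"
    using X Y unfolding iff by simp_all
  have eq: "A ** X = A ** Y"
  proof (rule symmetric_projectors_same_range_eq)
    show "transpose (A ** X) = A ** X" "transpose (A ** Y) = A ** Y"
      using X Y unfolding iff by simp_all
    show "A ** X ** (A ** Y) = A ** Y"
      by (metis core_EP_projector_power[OF Y'(1)] core_EP_projector_fixes_power[OF X']
          matpow_Suc_right matrix_mul_assoc)
    show "A ** Y ** (A ** X) = A ** X"
      by (metis core_EP_projector_power[OF X'(1)] core_EP_projector_fixes_power[OF Y']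
          matpow_Suc_right matrix_mul_assoc)
  qed
  have absorb: "X ** (A ** Z) = Z" if "A ** Z ** Z = Z" for Z
  proof -
    have "X ** (A ** Z) = X ** matpow A (Suc m) ** matpow Z (Suc m)"
      by (simp only: core_EP_projector_power[OF that, of m, symmetric] matrix_mul_assoc)
    also have "\<dots> = Z"
      by (simp only: X'(2) outer_power_absorb[OF that])
    finally show ?thesis .
  qed
  show ?thesis
    using absorb[OF X'(1)] absorb[OF Y'(1)] unfolding eq by (rule trans[OF sym])
qed

lemma dual_core_EP_eqI: "is_dual_core_EP A X \<Longrightarrow> dual_core_EP A = X"
  unfolding dual_core_EP_def by (blast intro: is_dual_core_EP_unique)

lemma is_dual_Drazin_iff:
  assumes "matrix_index (std_matrix A) = m"
  shows "is_dual_Drazin A D \<longleftrightarrow>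
    D ** matpow A (Suc m) = matpow A m \<and> D ** A ** D = D \<and> A ** D = D ** A"
  unfolding is_dual_Drazin_def using assms by simp

text \<open>
  Powers can be inserted into the idempotent \<open>D A\<close> in either order, so it factors through
  \<open>A\<^sup>k\<^sup>+\<^sup>1\<close> on both sides.
\<close>

lemma Drazin_projector_power:
  assumes "D ** A ** D = D" and "A ** D = D ** A"
  shows "matpow D (Suc k) ** matpow A (Suc k) = D ** A"
    and "matpow A (Suc k) ** matpow D (Suc k) = D ** A"
proof -
  have idem: "(D ** A) ** (D ** A) = D ** A"
    by (simp add: matrix_mul_assoc assms(1))
  show "matpow D (Suc k) ** matpow A (Suc k) = D ** A"
    using assms(2) idem by - (rule matpow_commuting_idempotent, simp_all)
  show "matpow A (Suc k) ** matpow D (Suc k) = D ** A"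
    using assms(2) idem matpow_commuting_idempotent[of A D k] by simp
qed

lemma Drazin_projector_fixes_power:
  assumes "D ** matpow A (Suc k) = matpow A k" and "A ** D = D ** A"
  shows "matpow A k ** (D ** A) = matpow A k" and "D ** A ** matpow A k = matpow A k"
proof -
  show left: "D ** A ** matpow A k = matpow A k"
    using assms(1) by (simp add: matrix_mul_assoc)
  have "matpow A j ** (D ** A) = (D ** A) ** matpow A j" for j
  proof (induction j)
    case (Suc j)
    then show ?case
      by (metis assms(2) matpow.simps(2) matrix_mul_assoc)
  qed simp
  with left show "matpow A k ** (D ** A) = matpow A k" by simp
qed

text \<open>
  The idempotents \<open>D A\<close> and \<open>D' A\<close> absorb each other, since each factors through a power of \<open>A\<close>
  that the other one fixes. Their equality gives \<open>D = D A D = D' A D = D' A D' = D'\<close>.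
\<close>

lemma is_dual_Drazin_unique:
  fixes A :: "dual ^ 'n ^ 'n"
  assumes D: "is_dual_Drazin A D" and D': "is_dual_Drazin A D'"
  shows "D = D'"
proof -
  define m where "m = matrix_index (std_matrix A)"
  note iff = is_dual_Drazin_iff[OF m_def[symmetric]]
  have D1: "D ** matpow A (Suc m) = matpow A m" "D ** A ** D = D" "A ** D = D ** A"
    and D2: "D' ** matpow A (Suc m) = matpow A m" "D' ** A ** D' = D'" "A ** D' = D' ** A"
    using D D' unfolding iff by simp_all
  have "D' ** A = D' ** A ** (D ** A)"
    by (metis Drazin_projector_power(1)[OF D2(2,3)] Drazin_projector_fixes_power(1)[OF D1(1,3)]
        matpow.simps(2) matrix_mul_assoc)
  also have "\<dots> = D ** A"
    by (metis Drazin_projector_power(2)[OF D1(2,3)] Drazin_projector_fixes_power(2)[OF D2(1,3)]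
        matpow_Suc_right matrix_mul_assoc)
  finally have eq: "D' ** A = D ** A" .
  show ?thesis
    by (metis eq D1(2,3) D2(2,3) matrix_mul_assoc)
qed

lemma dual_Drazin_eqI: "is_dual_Drazin A D \<Longrightarrow> dual_Drazin A = D"
  unfolding dual_Drazin_def by (blast intro: is_dual_Drazin_unique)

lemma Drazin_kernel_iff:
  fixes A :: "dual ^ 'n ^ 'n"
  assumes D: "is_dual_Drazin A D" and m: "matrix_index (std_matrix A) = m"
  shows "matpow A (Suc m) *v z = 0 \<longleftrightarrow> (\<exists>y. z = (mat 1 - D ** A) *v y)"
proof
  have D1: "D ** matpow A (Suc m) = matpow A m" "D ** A ** D = D" "A ** D = D ** A"
    using D unfolding is_dual_Drazin_iff[OF m] by simp_all
  {
    assume "matpow A (Suc m) *v z = 0"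
    then have "(D ** A) *v z = 0"
      by (metis Drazin_projector_power(1)[OF D1(2,3)] matrix_vector_mul_assoc matrix_vector_mult_0_right)
    then have "z = (mat 1 - D ** A) *v z"
      by (simp add: matrix_vector_mult_diff_rdistrib)
    then show "\<exists>y. z = (mat 1 - D ** A) *v y" ..
  next
    assume "\<exists>y. z = (mat 1 - D ** A) *v y"
    moreover have "matpow A (Suc m) ** (mat 1 - D ** A) = 0"
      using Drazin_projector_fixes_power(1)[OF D1(1,3)]
      by (simp add: matrix_diff_ldistrib flip: matrix_mul_assoc)
    ultimately show "matpow A (Suc m) *v z = 0"
      by (auto simp: matrix_vector_mul_assoc)
  }
qed

section \<open>The linear system\<close>

theorem theorem5p7:
  fixes A B :: "real ^ 'n ^ 'n" and Ahat :: "dual ^ 'n ^ 'n" and bhat :: "dual ^ 'n" and m :: nat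
  assumes "Ahat = dual_matrix A B"
    and "matrix_index A = m"
    and "\<exists>X. is_dual_core_EP Ahat X"
    and "\<exists>X. is_dual_Drazin Ahat X"
  shows "(\<exists>xhat. matpow Ahat (m + 1) *v xhat
            = (matpow Ahat (2 * m) ** dual_MP (matpow Ahat m)) *v bhat) \<and>
         {xhat. matpow Ahat (m + 1) *v xhat
            = (matpow Ahat (2 * m) ** dual_MP (matpow Ahat m)) *v bhat}
       = {dual_core_EP Ahat *v bhat + (mat 1 - dual_Drazin Ahat ** Ahat) *v yhat | yhat. True}"
proof -
  obtain X D where X: "is_dual_core_EP Ahat X" and D: "is_dual_Drazin Ahat D"
    using assms(3,4) by blast
  have m: "matrix_index (std_matrix Ahat) = m"
    using assms(1,2) by simp
  let ?C = "matpow Ahat m"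
  \<comment> \<open>The case \<open>m = 0\<close> is separate: there \<open>C\<close> is the identity, and \<open>C D\<^sup>m = D A\<close> is stated
    for positive powers.\<close>
  have "?C ** matpow D m ** ?C = ?C"
  proof (cases m)
    case (Suc k)
    then show ?thesis
      using D Drazin_projector_power(2)[of D Ahat k] Drazin_projector_fixes_power(2)[of D Ahat m]
      unfolding is_dual_Drazin_iff[OF m] by simp
  qed simp
  then obtain Y where Y: "is_dual_MP ?C Y"
    using regular_imp_is_dual_MP by blast
  then have "?C ** Y = Ahat ** X"
    by - (rule core_EP_projector_eq[OF X m], simp_all add: is_dual_MP_def)
  then have "matpow Ahat (2 * m) ** Y = matpow Ahat (Suc m) ** X"
    by (metis mult_2 matpow_add matpow_Suc_right matrix_mul_assoc)
  then have rhs: "(matpow Ahat (2 * m) ** dual_MP ?C) *v bhat = matpow Ahat (Suc m) *v (X *v bhat)"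
    by (simp only: dual_MP_eqI[OF Y] matrix_vector_mul_assoc)
  have "matpow Ahat (Suc m) *v x = matpow Ahat (Suc m) *v (X *v bhat) \<longleftrightarrow>
      (\<exists>y. x = X *v bhat + (mat 1 - D ** Ahat) *v y)" for x
  proof -
    have "matpow Ahat (Suc m) *v x = matpow Ahat (Suc m) *v (X *v bhat) \<longleftrightarrow>
        matpow Ahat (Suc m) *v (x - X *v bhat) = 0"
      by (simp only: matrix_vector_mult_diff_distrib right_minus_eq)
    also have "\<dots> \<longleftrightarrow> (\<exists>y. x - X *v bhat = (mat 1 - D ** Ahat) *v y)"
      by (rule Drazin_kernel_iff[OF D m])
    finally show ?thesis
      by (simp only: diff_eq_eq add.commute)
  qed
  then show ?thesis
    unfolding rhs dual_core_EP_eqI[OF X] dual_Drazin_eqI[OF D]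
    by (auto simp del: matpow.simps)
qed

end
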